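(* The set of coefficients $\{w(n) : n\in\mathbb{N}\}$ is dense in $C=\{z\in\mathbb{C} : |z|=1\}$, the unit circle in $\mathbb{C}$.
   Context: $\mathbb{N}=\{1,2,3,\dots\}$, $\mathbb{P}$ is the set of primes, and $G=\sum_{p\in\mathbb{P}} p^{-2}$. For $p\in\mathbb{P}$ and $k\ge 0$ put $\psi(p^k)=\frac{\pi}{p^2G}\left(1-\left(\frac{p-1}{p}\right)^k\right)$. The arithmetic function $w:\mathbb{N}\to\mathbb{C}$ is defined as the coefficients of the formal Dirichlet series $F(s)=\sum_{n=1}^\infty \frac{w(n)}{n^s} := \prod_{p\in\mathbb{P}}\left(\sum_{k=0}^\infty (-1)^k \frac{e^{i\psi(p^k)}}{p^{ks}}\right)$; explicitly, if $n=p_1^{k_1}\cdots p_J^{k_J}$ is the prime factorization of $n$ (distinct primes, $k_j\ge1$), then $w(n)=\prod_{j=1}^J (-1)^{k_j}e^{i\psi(p_j^{k_j})}$, and $w(1)=1$. *)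

theory Defs
  imports "HOL-Analysis.Analysis" "HOL-Computational_Algebra.Primes"
begin

definition G :: real where
  "G = (\<Sum>\<^sub>\<infinity>p\<in>{p::nat. prime p}. 1 / real p ^ 2)"

(* The value of psi at the prime power p^k, written as a function of p and k. *)
definition psi :: "nat \<Rightarrow> nat \<Rightarrow> real" where
  "psi p k = pi / (real p ^ 2 * G) * (1 - ((real p - 1) / real p) ^ k)"

(* The n-th coefficient of the formal Dirichlet series with Euler product
   prod_p (sum_k (-1)^k exp(i psi(p^k)) p^(-ks)).  The three lemmas below say that w is
   the multiplicative function with these local factors, which determines the series.
   Only n >= 1 is meaningful; w 0 has the junk value 1. *)
definition w :: "nat \<Rightarrow> complex" where
  "w n = (\<Prod>p\<in>prime_factors n.
            (-1) ^ multiplicity p n * exp (\<i> * complex_of_real (psi p (multiplicity p n))))"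

lemma w_1: "w 1 = 1"
  by (simp add: w_def)

lemma w_prime_power:
  fixes p k :: nat
  assumes "prime p"
  shows "w (p ^ k) = (-1) ^ k * exp (\<i> * complex_of_real (psi p k))"
proof (cases "k = 0")
  case True
  then show ?thesis by (simp add: w_def psi_def)
next
  case False
  then have "prime_factors (p ^ k) = {p}"
    using assms by (simp add: prime_factorization_prime_power)
  then show ?thesis
    using assms by (simp add: w_def multiplicity_prime_power)
qed

lemma w_mult_coprime:
  fixes m n :: nat
  assumes "coprime m n" "m > 0" "n > 0"
  shows "w (m * n) = w m * w n"
proof -
  define f where "f p k = (-1) ^ k * exp (\<i> * complex_of_real (psi p k))" for p k
  have disj: "prime_factors m \<inter> prime_factors n = {}"
    using assms(1) by (metis disjoint_iff coprime_common_divisor in_prime_factors_iff not_prime_unit)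
  have mult: "multiplicity p (m * n) = multiplicity p m + multiplicity p n" if "prime p" for p
    using that assms by (simp add: prime_elem_multiplicity_mult_distrib)
  have m: "f p (multiplicity p (m * n)) = f p (multiplicity p m)" if "p \<in> prime_factors m" for p
  proof -
    have "prime p" "multiplicity p n = 0"
      using that disj by (auto simp: prime_factors_multiplicity)
    then show ?thesis by (simp add: mult)
  qed
  have n: "f p (multiplicity p (m * n)) = f p (multiplicity p n)" if "p \<in> prime_factors n" for p
  proof -
    have "prime p" "multiplicity p m = 0"
      using that disj by (auto simp: prime_factors_multiplicity)
    then show ?thesis by (simp add: mult)
  qed
  have "w (m * n) = (\<Prod>p\<in>prime_factors m \<union> prime_factors n. f p (multiplicity p (m * n)))"
    using assms by (simp add: w_def f_def prime_factors_product)
  also have "\<dots> = (\<Prod>p\<in>prime_factors m. f p (multiplicity p (m * n))) *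
                  (\<Prod>p\<in>prime_factors n. f p (multiplicity p (m * n)))"
    using disj by (intro prod.union_disjoint) auto
  also have "\<dots> = w m * w n"
    using m n by (simp add: w_def f_def)
  finally show ?thesis .
qed

end

theory Submission
  imports Defs "HOL-Library.Discrete_Functions"
begin

text \<open>
  Write \<open>c\<^sub>p = pi / (p\<^sup>2 G)\<close>, so that the \<open>c\<^sub>p\<close> sum to \<open>pi\<close>. For fixed \<open>p\<close> the angle
  \<open>psi p k\<close> climbs from \<open>0\<close> towards \<open>c\<^sub>p\<close> by increments of which the first, \<open>c\<^sub>p / p\<close>, is the
  largest. Up to a sign, \<open>w n\<close> is the point of the unit circle whose angle is the sum of the
  \<open>psi p k\<close> over the prime powers exactly dividing \<open>n\<close>. The sign costs nothing: an
  extra large prime flips it and hardly changes the angle. Hence it is enough that the finite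
  sums of angles, with one choice of \<open>k\<close> for each prime, are dense in \<open>[0, pi]\<close>.

  A target below \<open>pi\<close> is approached greedily, one prime after the other: at \<open>p\<close> the least
  exponent is taken that leaves a remainder below what the later primes can contribute. No
  overshoot occurs (\<open>greedy_approximation\<close>) as long as no increment exceeds that contribution,
  that is, as long as \<open>1 / p\<^sup>3\<close> is at most the sum of \<open>1 / q\<^sup>2\<close> over the primes \<open>q > p\<close>. This is
  also necessary: a sum that involves a prime up to \<open>p\<close> is at least \<open>c\<^sub>p / p\<close>, any other is at
  most the contribution of the primes beyond \<open>p\<close>, so there would be a gap between the two.

  So the heart of the matter is arithmetic. For \<open>p = 2\<close> the primes 3 and 5 do, and for odd \<open>p\<close>
  a single prime \<open>q > p\<close> with \<open>q\<^sup>2 \<le> p\<^sup>3\<close> does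
  (\<open>ex_prime_between_power_three_halves\<close>). If there were none, the primes up to
  \<open>N = p \<surd>p\<close> would be those up to \<open>p\<close>, at most \<open>p / 2\<close> in number. But every
  number \<open>k (N choose k)\<close> divides the least common multiple of \<open>1, \<dots>, N\<close>, whose prime powers are
  all at most \<open>N\<close>; so about \<open>2\<^sup>N\<close> is a lower bound for \<open>N\<close> to the number of primes up to
  \<open>N\<close>, hence for \<open>N\<close> to the power \<open>p / 2\<close>, which is far too small.
  The exponent \<open>3/2\<close> exceeds 1, which is why the crude count by parity suffices.
\<close>

section \<open>A prime between p and p to the power 3/2\<close>

text \<open>
  The numbers \<open>1 / (k (n choose k))\<close> are the entries of Leibniz's harmonic triangle: the first
  in row \<open>n\<close> is \<open>1 / n\<close>, and each further entry is a difference of two entries in the preceding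
  column. So a common denominator of the first column clears all denominators up to row \<open>n\<close>.
\<close>

lemma leibniz_denominator_dvd:
  fixes D k n :: nat
  assumes "1 \<le> k" "k \<le> n" "\<And>m. 1 \<le> m \<Longrightarrow> m \<le> n \<Longrightarrow> m dvd D"
  shows "k * (n choose k) dvd D"
proof -
  have "real D / real (k * (n choose k)) \<in> \<int>"
    using assms
  proof (induction k arbitrary: n rule: nat_induct_at_least)
    case base
    then have "n dvd D" by simp
    then obtain z where "D = n * z" by blast
    then show ?case using base by simp
  next
    case (Suc k)
    define B where "B = ((n - 1) choose k)"
    have n: "n > k" "k \<ge> 1" using Suc by auto
    then have B: "B > 0" by (simp add: B_def)
    have 1: "real (Suc k * (n choose Suc k)) = real n * real B"
      unfolding B_def by (subst binomial_absorption) simp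
    have "(n - k) * (n choose k) = n * B"
      unfolding B_def by (rule binomial_absorb_comp)
    then have "(real n - real k) * real (n choose k) = real n * real B"
      using n by (metis less_imp_le_nat of_nat_diff of_nat_mult)
    then have 2: "real (n choose k) = real n * real B / (real n - real k)"
      using n by (simp add: field_simps)
    have "real D / real (Suc k * (n choose Suc k)) =
        real D / real (k * ((n - 1) choose k)) - real D / real (k * (n choose k))"
      unfolding 1 unfolding of_nat_mult 2 B_def[symmetric] using n B by (simp add: field_simps)
    moreover have "real D / real (k * ((n - 1) choose k)) \<in> \<int>"
      using Suc n by (intro Suc.IH) auto
    moreover have "real D / real (k * (n choose k)) \<in> \<int>"
      using Suc n by (intro Suc.IH) auto
    ultimately show ?case by simp
  qed
  then obtain z where "real D / real (k * (n choose k)) = of_int z" by (auto elim: Ints_cases)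
  moreover have "real (k * (n choose k)) \<noteq> 0"
    using assms by simp
  ultimately have "real D = of_int z * real (k * (n choose k))"
    by (simp add: field_simps del: of_nat_mult)
  then have "real_of_int (int D) = real_of_int (z * int (k * (n choose k)))" by simp
  then have "int D = z * int (k * (n choose k))" by (simp only: of_int_eq_iff)
  then have "int (k * (n choose k)) dvd int D" by simp
  then show ?thesis by (simp only: of_nat_dvd_iff)
qed

text \<open>
  The witness is the least common multiple of \<open>1, \<dots>, n\<close>, given by its factorization: each prime
  contributes its largest power not exceeding \<open>n\<close>.
\<close>

lemma common_multiple_le_power_card_primes:
  fixes n :: nat
  assumes "n \<ge> 1"
  obtains D where "0 < D" "D \<le> n ^ card {q. prime q \<and> q \<le> n}"
    "\<And>m. 1 \<le> m \<Longrightarrow> m \<le> n \<Longrightarrow> m dvd D"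
proof
  define P where "P = {q::nat. prime q \<and> q \<le> n}"
  define e where "e q = Max {k. q ^ k \<le> n}" for q :: nat
  define D where "D = (\<Prod>q\<in>P. q ^ e q)"
  have finP: "finite P" by (rule finite_subset[of _ "{..n}"]) (auto simp: P_def)
  have fin: "finite {k. q ^ k \<le> n}" if "q \<in> P" for q
  proof (rule finite_subset)
    have "q > 1" using that prime_gt_1_nat by (auto simp: P_def)
    then show "{k. q ^ k \<le> n} \<subseteq> {..n}"
      by (auto intro: less_imp_le[OF power_gt_expt] le_trans)
  qed simp
  have le: "q ^ e q \<le> n" if "q \<in> P" for q
  proof -
    have "0 \<in> {k. q ^ k \<le> n}" using assms by simp
    then have "e q \<in> {k. q ^ k \<le> n}" unfolding e_def using fin[OF that] by (intro Max_in) blast+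
    then show ?thesis by simp
  qed
  show "0 < D" unfolding D_def P_def by (intro prod_pos) (auto simp: prime_gt_0_nat)
  have "D \<le> (\<Prod>q\<in>P. n)" unfolding D_def using le by (intro prod_mono) auto
  then show "D \<le> n ^ card {q. prime q \<and> q \<le> n}" by (simp add: P_def)
  show "m dvd D" if m: "1 \<le> m" "m \<le> n" for m
  proof -
    have sub: "prime_factors m \<subseteq> P"
      using m by (auto simp: P_def in_prime_factors_iff dest!: dvd_imp_le)
    have "m = (\<Prod>q\<in>prime_factors m. q ^ multiplicity q m)"
      using m prime_factorization_nat by auto
    also have "\<dots> dvd (\<Prod>q\<in>prime_factors m. q ^ e q)"
    proof (intro prod_dvd_prod le_imp_power_dvd)
      fix q assume q: "q \<in> prime_factors m"
      have "q ^ multiplicity q m \<le> n"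
        using m by (intro le_trans[OF dvd_imp_le m(2)] multiplicity_dvd) auto
      then show "multiplicity q m \<le> e q"
        unfolding e_def using fin q sub by (intro Max_ge) auto
    qed
    also have "\<dots> dvd D"
      unfolding D_def using finP sub by (rule prod_dvd_prod_subset)
    finally show ?thesis .
  qed
qed

text \<open>
  A Chebyshev-type lower bound for the number of primes: \<open>n (2n choose n)\<close>, which is at least
  \<open>4\<^sup>n / 2\<close>, divides a number bounded in terms of that count.
\<close>

lemma four_power_le_power_card_primes:
  fixes n :: nat
  assumes "n \<ge> 1"
  shows "4 ^ n \<le> 2 * (2 * n) ^ card {q. prime q \<and> q \<le> 2 * n}"
proof -
  obtain D where D: "0 < D" "D \<le> (2 * n) ^ card {q. prime q \<and> q \<le> 2 * n}"
    "\<And>m. 1 \<le> m \<Longrightarrow> m \<le> 2 * n \<Longrightarrow> m dvd D"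
    using common_multiple_le_power_card_primes[of "2 * n"] assms by auto
  have "n * ((2 * n) choose n) dvd D"
    using assms D(3) by (intro leibniz_denominator_dvd) auto
  then have 1: "n * ((2 * n) choose n) \<le> D" using D(1) by (rule dvd_imp_le)
  have "4 ^ n / (2 * real n) \<le> real ((2 * n) choose n)"
    using assms by (intro central_binomial_lower_bound) auto
  then have "4 ^ n \<le> 2 * (real n * real ((2 * n) choose n))"
    using assms by (simp add: field_simps)
  then have "real (4 ^ n) \<le> real (2 * (n * ((2 * n) choose n)))"
    by simp
  then have "4 ^ n \<le> 2 * (n * ((2 * n) choose n))" by (simp only: of_nat_le_iff)
  with 1 D(2) show ?thesis by linarith
qed

text \<open>
  There are \<open>(p - 1) div 2\<close> odd numbers from 3 to \<open>p\<close>. Among them 9 is not prime, and its place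
  is free for the prime 2.
\<close>

lemma card_primes_le_half:
  fixes p :: nat
  assumes "odd p" "p \<ge> 9"
  shows "card {q. prime q \<and> q \<le> p} \<le> (p - 1) div 2"
proof -
  define h where "h q = (if q = 2 then 4 else q div 2)" for q :: nat
  define A where "A = {q. prime q \<and> q \<le> p}"
  have odd: "odd q" "q \<noteq> 9" if "q \<in> A" "q \<noteq> 2" for q
  proof -
    have "prime q" using that by (simp add: A_def)
    then show "odd q" using that(2) prime_ge_2_nat[of q] prime_odd_nat[of q] by force
    have "\<not> prime (9 :: nat)" by simp
    then show "q \<noteq> 9" using \<open>prime q\<close> by blast
  qed
  have inj: "inj_on h A"
  proof (rule inj_onI)
    fix a b assume ab: "a \<in> A" "b \<in> A" "h a = h b"
    show "a = b"
      using odd[OF ab(1)] odd[OF ab(2)] ab(3) unfolding h_def by (auto split: if_splits elim!: oddE)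
  qed
  have "h ` A \<subseteq> {1..(p - 1) div 2}"
  proof
    fix y assume "y \<in> h ` A"
    then obtain q where q: "q \<in> A" "y = h q" by blast
    then have "q \<ge> 2" "q \<le> p" by (auto simp: A_def prime_ge_2_nat)
    then show "y \<in> {1..(p - 1) div 2}"
      using odd[OF q(1)] q(2) assms unfolding h_def by (auto elim!: oddE)
  qed
  then have "card A \<le> card {1..(p - 1) div 2}"
    by (metis card_inj_on_le finite_atLeastAtMost inj)
  then show ?thesis by (simp add: A_def)
qed

text \<open>
  With \<open>s\<close> the integer part of \<open>\<surd>p\<close>, the left side bounds \<open>p s\<close>, as \<open>p < (s + 1)\<^sup>2\<close>.
\<close>

lemma sq_mult_le_four_power:
  fixes s :: nat
  assumes "s \<ge> 3"
  shows "s * (s\<^sup>2 + 2 * s) \<le> 4 ^ s"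
  using assms
proof (induction s rule: nat_induct_at_least)
  case base
  then show ?case by simp
next
  case (Suc n)
  have "Suc n * ((Suc n)\<^sup>2 + 2 * Suc n) = n * (n\<^sup>2 + 2 * n) + 3 * (n * n) + 7 * n + 3"
    by (simp add: power2_eq_square algebra_simps)
  also have "\<dots> \<le> 4 * (n * (n\<^sup>2 + 2 * n))"
  proof -
    have "n * (n * n) \<ge> 3 * (n * n)" "n * n \<ge> 3 * n" using Suc.hyps by auto
    moreover have "n * (n\<^sup>2 + 2 * n) = n * (n * n) + 2 * (n * n)"
      by (simp add: power2_eq_square algebra_simps)
    ultimately show ?thesis using Suc.hyps by linarith
  qed
  finally show ?case using Suc.IH by simp
qed

text \<open>
  Without such a prime, there are at most \<open>(p - 1) / 2\<close> primes up to \<open>p s\<close>, where \<open>s\<close> is the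
  integer part of \<open>\<surd>p\<close>. Since \<open>p s \<le> 4\<^sup>s\<close>, the Chebyshev-type bound turns into
  \<open>p s - 1 \<le> s (p - 1) + 1\<close>, which is false for \<open>s \<ge> 3\<close>.
\<close>

lemma ex_prime_between_power_three_halves:
  fixes p :: nat
  assumes "odd p" "p \<ge> 11"
  shows "\<exists>q. prime q \<and> p < q \<and> q\<^sup>2 \<le> p ^ 3"
proof (rule ccontr)
  assume no: "\<not> ?thesis"
  define s where "s = floor_sqrt p"
  have s2: "s\<^sup>2 \<le> p" unfolding s_def by (rule floor_sqrt_power2_le)
  have "p < (Suc s)\<^sup>2" unfolding s_def by (rule Suc_floor_sqrt_power2_gt)
  then have ps: "p \<le> s\<^sup>2 + 2 * s" by (simp add: power2_eq_square)
  have s3: "s \<ge> 3"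
  proof (rule ccontr)
    assume "\<not> s \<ge> 3"
    then have "s \<le> 2" by simp
    then have "s\<^sup>2 \<le> 2\<^sup>2" "s \<le> 2" by (simp_all only: power_mono)
    then show False using ps assms by simp
  qed
  (* The bound is for even arguments only, so p s is rounded down to 2 n. *)
  define n where "n = (p * s) div 2"
  have n: "2 * n \<le> p * s" "p * s \<le> 2 * n + 1" unfolding n_def by auto
  have n1: "n \<ge> 1"
  proof -
    have "11 * 3 \<le> p * s" using assms s3 by (intro mult_mono) auto
    then show ?thesis using n by linarith
  qed
  have sub: "{q. prime q \<and> q \<le> 2 * n} \<subseteq> {q. prime q \<and> q \<le> p}"
  proof safe
    fix q :: nat assume q: "prime q" "q \<le> 2 * n"
    have "q\<^sup>2 \<le> (p * s)\<^sup>2" using q n by (intro power_mono) auto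
    also have "\<dots> = p\<^sup>2 * s\<^sup>2" by (simp add: power_mult_distrib)
    also have "\<dots> \<le> p\<^sup>2 * p" using s2 by simp
    also have "\<dots> = p ^ 3" by (simp add: power2_eq_square power3_eq_cube)
    finally show "q \<le> p" using no q by (meson not_le)
  qed
  have "card {q. prime q \<and> q \<le> 2 * n} \<le> card {q. prime q \<and> q \<le> p}"
    by (intro card_mono sub) (auto intro: finite_subset[of _ "{..p}"])
  also have "\<dots> \<le> (p - 1) div 2" using assms by (intro card_primes_le_half) auto
  finally have card: "card {q. prime q \<and> q \<le> 2 * n} \<le> (p - 1) div 2" .
  have "p * s \<le> 4 ^ s"
    using mult_le_mono2[OF ps, of s] sq_mult_le_four_power[OF s3] by (simp only: mult.commute[of p])
  then have 2: "2 * n \<le> 4 ^ s" using n by simp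
  have "2 * ((p - 1) div 2) = p - 1" using assms by (auto elim!: oddE)
  then have half: "2 * (s * ((p - 1) div 2)) = s * (p - 1)" by (metis mult.left_commute)
  have "(2::nat) ^ (2 * n) = 4 ^ n" by (simp add: power_mult)
  also have "\<dots> \<le> 2 * (2 * n) ^ card {q. prime q \<and> q \<le> 2 * n}"
    using n1 by (rule four_power_le_power_card_primes)
  also have "\<dots> \<le> 2 * (2 * n) ^ ((p - 1) div 2)"
    using card n1 by (intro mult_left_mono power_increasing) auto
  also have "\<dots> \<le> 2 * (4 ^ s) ^ ((p - 1) div 2)"
    using 2 by (intro mult_left_mono power_mono) auto
  also have "\<dots> = 2 * 2 ^ (2 * (s * ((p - 1) div 2)))" by (simp add: power_mult)
  also have "\<dots> = 2 ^ (s * (p - 1) + 1)" unfolding half by simp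
  finally have "(2::nat) ^ (2 * n) \<le> 2 ^ (s * (p - 1) + 1)" .
  then have "2 * n \<le> s * (p - 1) + 1" by (rule power_le_imp_le_exp[rotated]) simp
  moreover have "s * (p - 1) + s = p * s" using assms by (cases p) auto
  ultimately show False using n s3 by linarith
qed

text \<open>
  For \<open>p = 2\<close> one prime is not enough, since \<open>1/9 < 1/8\<close>; but \<open>1/9 + 1/25 > 1/8\<close>.
\<close>

lemma ex_primes_beyond_cube_reciprocal:
  fixes p :: nat
  assumes "prime p"
  obtains B where "finite B" "\<And>q. q \<in> B \<Longrightarrow> prime q \<and> p < q"
    "1 / real p ^ 3 \<le> (\<Sum>q\<in>B. 1 / real q ^ 2)"
proof (cases "p = 2")
  case True
  show ?thesis by (rule that[of "{3, 5}"]) (auto simp: True)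
next
  case False
  then have "odd p" using assms prime_odd_nat prime_ge_2_nat[of p] by force
  have "\<exists>q. prime q \<and> p < q \<and> q\<^sup>2 \<le> p ^ 3"
  proof (cases "p \<ge> 11")
    case True
    then show ?thesis by (rule ex_prime_between_power_three_halves[OF \<open>odd p\<close>])
  next
    case False
    with \<open>odd p\<close> assms have "p = 3 \<or> p = 5 \<or> p = 7 \<or> p = 9"
      using prime_ge_2_nat[of p] by (auto elim!: oddE)
    moreover have "prime (5::nat)" "prime (7::nat)" "prime (11::nat)" by simp_all
    ultimately show ?thesis by (elim disjE) (auto intro: exI[of _ 5] exI[of _ 7] exI[of _ 11])
  qed
  then obtain q where q: "prime q" "p < q" "q\<^sup>2 \<le> p ^ 3" by blast
  have "real q ^ 2 \<le> real p ^ 3" using q(3) by (metis of_nat_le_iff of_nat_power)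
  then have "1 / real p ^ 3 \<le> 1 / real q ^ 2" using q prime_gt_0_nat[OF assms]
    by (intro divide_left_mono) auto
  then show ?thesis using q by (intro that[of "{q}"]) auto
qed

section \<open>Sums of angles fill the half circle\<close>

text \<open>
  Here \<open>T n\<close> is the tail \<open>c n + c (n + 1) + \<dots>\<close>, the most that the terms from \<open>n\<close> on can still
  contribute. The invariant of the greedy choice is that the remainder lies in \<open>[0, T M)\<close> after
  \<open>M\<close> terms. Taking the least \<open>j\<close> that brings the remainder below \<open>T (M + 1)\<close> keeps it
  nonnegative, because one step earlier it was still at least \<open>T (M + 1)\<close> and the last
  increment is no larger than this.
\<close>

lemma greedy_approximation:
  fixes f :: "nat \<Rightarrow> nat \<Rightarrow> real" and c T :: "nat \<Rightarrow> real"
  assumes f0: "\<And>n. f n 0 = 0" and lim: "\<And>n. f n \<longlonglongrightarrow> c n"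
    and gap: "\<And>n j. f n (Suc j) - f n j \<le> T (Suc n)"
    and T: "\<And>n. T n = c n + T (Suc n)" "T \<longlonglongrightarrow> 0"
    and x: "0 \<le> x" "x < T 0" and e: "e > 0"
  obtains k M where "(\<Sum>n<M. f n (k n)) \<le> x" "x < (\<Sum>n<M. f n (k n)) + e"
proof -
  have greedy: "\<exists>k. 0 \<le> x - (\<Sum>n<M. f n (k n)) \<and> x - (\<Sum>n<M. f n (k n)) < T M" for M
  proof (induction M)
    case 0
    then show ?case using x by simp
  next
    case (Suc M)
    then obtain k where k: "0 \<le> x - (\<Sum>n<M. f n (k n))" "x - (\<Sum>n<M. f n (k n)) < T M"
      by blast
    define r where "r = x - (\<Sum>n<M. f n (k n))"
    define P where "P j \<longleftrightarrow> r - f M j < T (Suc M)" for j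
    have "(\<lambda>j. r - f M j) \<longlonglongrightarrow> r - c M" by (intro tendsto_intros lim)
    moreover have "r - c M < T (Suc M)" using k(2) T(1)[of M] by (simp add: r_def)
    ultimately have "eventually P sequentially" unfolding P_def by (rule order_tendstoD)
    then have ex: "\<exists>j. P j" by (auto simp: eventually_sequentially)
    define j where "j = (LEAST j. P j)"
    have j: "P j" unfolding j_def using ex by (rule LeastI_ex)
    have "0 \<le> r - f M j"
    proof (cases j)
      case 0
      then show ?thesis using k(1) f0 by (simp add: r_def)
    next
      case (Suc i)
      then have "\<not> P i" unfolding j_def by (metis not_less_Least lessI)
      then show ?thesis using gap[of M i] by (simp add: P_def Suc)
    qed
    moreover have "(\<Sum>n<M. f n ((k(M := j)) n)) = (\<Sum>n<M. f n (k n))"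
      by (intro sum.cong) auto
    ultimately show ?case using j by (intro exI[of _ "k(M := j)"]) (simp add: P_def r_def)
  qed
  have "eventually (\<lambda>M. T M < e) sequentially" using T(2) e by (rule order_tendstoD)
  then obtain M where "T M < e" by (auto simp: eventually_sequentially)
  moreover obtain k where "0 \<le> x - (\<Sum>n<M. f n (k n))" "x - (\<Sum>n<M. f n (k n)) < T M"
    using greedy by blast
  ultimately show ?thesis by (intro that[of k M]) auto
qed

text \<open>
  Extending by 0 to the composite numbers makes the sum over primes an ordinary series, whose
  tails can be split one term at a time.
\<close>

definition prime_recip_sq :: "nat \<Rightarrow> real" where
  "prime_recip_sq n = (if prime n then 1 / real n ^ 2 else 0)"

lemma prime_recip_sq_nonneg: "prime_recip_sq n \<ge> 0"
  by (simp add: prime_recip_sq_def)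

lemma summable_prime_recip_sq: "summable prime_recip_sq"
proof (rule summable_comparison_test')
  show "summable (\<lambda>n. inverse (real n ^ 2))" by (rule inverse_power_summable) simp
  show "norm (prime_recip_sq n) \<le> inverse (real n ^ 2)" for n
    by (simp add: prime_recip_sq_def inverse_eq_divide)
qed

lemma G_eq_suminf: "G = suminf prime_recip_sq"
proof -
  have "G = infsum prime_recip_sq UNIV"
    unfolding G_def by (rule infsum_cong_neutral) (auto simp: prime_recip_sq_def)
  also have "\<dots> = suminf prime_recip_sq"
    using summable_prime_recip_sq
    by (intro infsumI sums_nonneg_imp_has_sum prime_recip_sq_nonneg) (simp add: summable_sums)
  finally show ?thesis .
qed

lemma G_pos: "G > 0"
  unfolding G_eq_suminf
  by (rule suminf_pos2[OF summable_prime_recip_sq prime_recip_sq_nonneg, of 2])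
     (simp add: prime_recip_sq_def)

lemma sum_le_suminf_tail:
  fixes f :: "nat \<Rightarrow> real"
  assumes "summable f" "\<And>n. f n \<ge> 0" "finite B" "B \<subseteq> {m..}"
  shows "sum f B \<le> (\<Sum>i. f (i + m))"
proof -
  have "sum f B = (\<Sum>i\<in>(\<lambda>q. q - m) ` B. f (i + m))"
    using assms(4) by (subst sum.reindex) (auto intro!: inj_on_diff_nat sum.cong)
  also have "\<dots> \<le> (\<Sum>i. f (i + m))"
    using assms by (intro sum_le_suminf summable_ignore_initial_segment) auto
  finally show ?thesis .
qed

lemma psi_0: "psi p 0 = 0"
  by (simp add: psi_def)

lemma psi_tendsto:
  assumes "prime p"
  shows "psi p \<longlonglongrightarrow> pi / (real p ^ 2 * G)"
proof -
  have p: "real p \<ge> 1" using prime_ge_1_nat[OF assms] by simp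
  then have "(\<lambda>j. ((real p - 1) / real p) ^ j) \<longlonglongrightarrow> 0"
    by (intro LIMSEQ_power_zero)
      (simp add: abs_if divide_less_eq zero_less_mult_iff)
  then have "(\<lambda>j. pi / (real p ^ 2 * G) * (1 - ((real p - 1) / real p) ^ j))
      \<longlonglongrightarrow> pi / (real p ^ 2 * G) * (1 - 0)"
    by (intro tendsto_mult tendsto_diff tendsto_const)
  then show ?thesis by (simp add: psi_def[abs_def])
qed

lemma psi_increment_le:
  assumes "prime p"
  shows "psi p (Suc j) - psi p j \<le> pi / G * (1 / real p ^ 3)"
proof -
  define r where "r = (real p - 1) / real p"
  have p: "real p \<ge> 1" using prime_ge_1_nat[OF assms] by simp
  then have r: "0 \<le> r" "r \<le> 1" by (auto simp: r_def)
  have "psi p (Suc j) - psi p j = pi / (real p ^ 2 * G) * (1 - r) * r ^ j"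
    unfolding psi_def r_def[symmetric] power_Suc
    by (simp only: mult.assoc right_diff_distrib left_diff_distrib)
  also have "1 - r = 1 / real p" using p by (simp add: r_def field_simps)
  also have "pi / (real p ^ 2 * G) * (1 / real p) * r ^ j \<le> pi / (real p ^ 2 * G) * (1 / real p) * 1"
    using r G_pos by (intro mult_left_mono power_le_one) auto
  also have "\<dots> = pi / G * (1 / real p ^ 3)" by (simp add: power2_eq_square power3_eq_cube)
  finally show ?thesis .
qed

text \<open>
  The greedy choice runs over all natural numbers, with angle 0 at those that are not prime. Its
  hypothesis on the increments is the comparison of \<open>1 / p\<^sup>3\<close> with the primes beyond \<open>p\<close>, scaled
  by \<open>pi / G\<close>; the total available is exactly \<open>pi\<close> by the choice of \<open>G\<close>.
\<close>

lemma psi_sums_dense: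
  assumes "0 \<le> x" "x < pi" "e > 0"
  obtains A k where "finite A" "\<And>p. p \<in> A \<Longrightarrow> prime p"
    "(\<Sum>p\<in>A. psi p (k p)) \<le> x" "x < (\<Sum>p\<in>A. psi p (k p)) + e"
proof -
  define f where "f n j = (if prime n then psi n j else 0)" for n j
  define T where "T n = pi / G * (\<Sum>i. prime_recip_sq (i + n))" for n
  obtain k M where kM: "(\<Sum>n<M. f n (k n)) \<le> x" "x < (\<Sum>n<M. f n (k n)) + e"
  proof (rule greedy_approximation[of f "\<lambda>n. pi / G * prime_recip_sq n" T x e])
    show "f n 0 = 0" for n by (simp add: f_def psi_0)
    show "f n \<longlonglongrightarrow> pi / G * prime_recip_sq n" for n
      using psi_tendsto[of n] by (cases "prime n") (simp_all add: f_def[abs_def] prime_recip_sq_def mult.commute)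
    show "f n (Suc j) - f n j \<le> T (Suc n)" for n j
    proof (cases "prime n")
      case True
      obtain B where B: "finite B" "\<And>q. q \<in> B \<Longrightarrow> prime q \<and> n < q"
        "1 / real n ^ 3 \<le> (\<Sum>q\<in>B. 1 / real q ^ 2)"
        using ex_primes_beyond_cube_reciprocal[OF True] by blast
      have "(\<Sum>q\<in>B. 1 / real q ^ 2) = sum prime_recip_sq B"
        using B(2) by (intro sum.cong) (auto simp: prime_recip_sq_def)
      also have "\<dots> \<le> (\<Sum>i. prime_recip_sq (i + Suc n))"
        using B(1,2) by (intro sum_le_suminf_tail summable_prime_recip_sq prime_recip_sq_nonneg)
          (auto simp: Suc_le_eq)
      finally have "pi / G * (1 / real n ^ 3) \<le> T (Suc n)"
        unfolding T_def using B(3) G_pos by (intro mult_left_mono) auto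
      then show ?thesis using psi_increment_le[OF True, of j] True by (simp add: f_def)
    next
      case False
      have "0 \<le> (\<Sum>i. prime_recip_sq (i + Suc n))"
        by (intro suminf_nonneg summable_ignore_initial_segment summable_prime_recip_sq
            prime_recip_sq_nonneg)
      then show ?thesis using False G_pos by (simp add: f_def T_def)
    qed
    show "T n = pi / G * prime_recip_sq n + T (Suc n)" for n
      using suminf_split_head[OF summable_ignore_initial_segment[OF summable_prime_recip_sq], of n]
      by (simp add: T_def right_diff_distrib diff_divide_distrib)
    have "(\<lambda>n. \<Sum>i. prime_recip_sq (i + n)) \<longlonglongrightarrow> 0"
      using suminf_exist_split[OF _ summable_prime_recip_sq] by (simp add: LIMSEQ_iff)
    then show "T \<longlonglongrightarrow> 0" unfolding T_def[abs_def] by (intro tendsto_mult_right_zero)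
    show "x < T 0" using assms G_pos by (simp add: T_def G_eq_suminf[symmetric])
  qed (use assms in auto)
  have "(\<Sum>n<M. f n (k n)) = (\<Sum>p\<in>{p. prime p \<and> p < M}. psi p (k p))"
    by (rule sum.mono_neutral_cong_right) (auto simp: f_def)
  then show ?thesis using kM by (intro that[of "{p. prime p \<and> p < M}" k]) auto
qed

section \<open>Density of the coefficients\<close>

lemma w_prod_prime_powers:
  assumes "finite A" "\<And>p. p \<in> A \<Longrightarrow> prime p"
  shows "w (\<Prod>p\<in>A. p ^ k p) =
    (-1) ^ (\<Sum>p\<in>A. k p) * exp (\<i> * complex_of_real (\<Sum>p\<in>A. psi p (k p)))"
  using assms
proof (induction A)
  case empty
  then show ?case using w_1 by simp
next
  case (insert q A)
  have "coprime (q ^ k q) (\<Prod>p\<in>A. p ^ k p)"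
    using insert by (intro prod_coprime_right coprime_power_left_iff[THEN iffD2] disjI1
        coprime_power_right_iff[THEN iffD2] primes_coprime) auto
  moreover have "q ^ k q > 0" "(\<Prod>p\<in>A. p ^ k p) > 0"
    using insert by (auto intro!: prod_pos simp: prime_gt_0_nat)
  ultimately have "w (q ^ k q * (\<Prod>p\<in>A. p ^ k p)) = w (q ^ k q) * w (\<Prod>p\<in>A. p ^ k p)"
    by (rule w_mult_coprime)
  then show ?case
    using insert by (simp add: w_prime_power power_add exp_add distrib_left)
qed

lemma norm_w: "norm (w n) = 1"
  by (simp add: w_def norm_mult norm_power flip: prod_norm)

lemma norm_exp_i_diff_le:
  fixes a b :: real
  shows "norm (exp (\<i> * complex_of_real a) - exp (\<i> * complex_of_real b)) \<le> \<bar>a - b\<bar>"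
proof -
  have "exp (\<i> * complex_of_real a) - exp (\<i> * complex_of_real b)
      = exp (\<i> * complex_of_real b) * (exp (\<i> * complex_of_real (a - b)) - 1)"
    by (simp add: algebra_simps flip: exp_add)
  then have "norm (exp (\<i> * complex_of_real a) - exp (\<i> * complex_of_real b))
      = 2 * \<bar>sin ((a - b) / 2)\<bar>"
    by (simp only: norm_mult norm_exp_i_times dist_exp_i_1)
  also have "\<dots> \<le> \<bar>a - b\<bar>" using abs_sin_x_le_abs_x[of "(a - b) / 2"] by simp
  finally show ?thesis .
qed

text \<open>
  If the parity of the exponents produces the wrong sign, one more prime \<open>q\<close> with exponent 1 is
  included. Its angle is at most \<open>pi / (G q)\<close>, which is below \<open>e\<close> for large \<open>q\<close>. The sum of the
  angles was in \<open>(x - e, x]\<close> before, so it moves up by less than \<open>e\<close> and stays within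
  \<open>e\<close> of \<open>x\<close>.
\<close>

lemma w_approximates_signed:
  assumes "0 \<le> x" "x < pi" "e > 0" and u: "u = 1 \<or> u = -1"
  shows "\<exists>n\<ge>1. norm (w n - u * exp (\<i> * complex_of_real x)) < e"
proof -
  obtain A k where A: "finite A" "\<And>p. p \<in> A \<Longrightarrow> prime p"
    "(\<Sum>p\<in>A. psi p (k p)) \<le> x" "x < (\<Sum>p\<in>A. psi p (k p)) + e"
    using psi_sums_dense[OF assms(1-3)] by metis
  have "\<exists>B l. finite B \<and> (\<forall>p\<in>B. prime p) \<and> \<bar>(\<Sum>p\<in>B. psi p (l p)) - x\<bar> < e \<and>
      (-1) ^ (\<Sum>p\<in>B. l p) = u"
  proof (cases "(-1) ^ (\<Sum>p\<in>A. k p) = u")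
    case True
    then show ?thesis using A by (intro exI[of _ A] exI[of _ k]) auto
  next
    case False
    then have flip: "- ((-1) ^ (\<Sum>p\<in>A. k p)) = u"
      using u by (cases "even (\<Sum>p\<in>A. k p)") auto
    obtain N where N: "\<And>p. p \<in> A \<Longrightarrow> p \<le> N" using A(1) by (meson finite_nat_set_iff_bounded_le)
    define R where "R = nat \<lceil>pi / (G * e)\<rceil>"
    obtain q where q: "prime q" "q > max N R" using bigger_prime by blast
    have "pi / (G * e) \<le> real R" unfolding R_def by linarith
    then have "pi / (G * e) < real q" using q(2) by linarith
    then have "pi / G * (1 / real q) < e"
      using G_pos assms(3) prime_gt_0_nat[OF q(1)] by (simp add: field_simps)
    moreover have "psi q (Suc 0) \<le> pi / G * (1 / real q)"
    proof -
      have "real q \<le> real q ^ 3" using prime_ge_1_nat[OF q(1)] by (intro self_le_power) auto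
      then have "1 / real q ^ 3 \<le> 1 / real q"
        using prime_gt_0_nat[OF q(1)] by (intro divide_left_mono) auto
      then have "pi / G * (1 / real q ^ 3) \<le> pi / G * (1 / real q)"
        using G_pos by (intro mult_left_mono) auto
      then show ?thesis using psi_increment_le[OF q(1), of 0] by (simp add: psi_0)
    qed
    moreover have "0 \<le> psi q (Suc 0)"
      using G_pos prime_gt_0_nat[OF q(1)] by (simp add: psi_def)
    moreover have "q \<notin> A" using N q(2) by force
    moreover have "(\<Sum>p\<in>A. psi p ((k(q := 1)) p)) = (\<Sum>p\<in>A. psi p (k p))"
      "(\<Sum>p\<in>A. (k(q := 1)) p) = (\<Sum>p\<in>A. k p)"
      using \<open>q \<notin> A\<close> by (auto intro!: sum.cong)
    ultimately show ?thesis using A flip q(1)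
      by (intro exI[of _ "insert q A"] exI[of _ "k(q := 1)"]) auto
  qed
  then obtain B l where B: "finite B" "\<And>p. p \<in> B \<Longrightarrow> prime p"
    "\<bar>(\<Sum>p\<in>B. psi p (l p)) - x\<bar> < e" "(-1) ^ (\<Sum>p\<in>B. l p) = u" by blast
  define n where "n = (\<Prod>p\<in>B. p ^ l p)"
  define s where "s = (\<Sum>p\<in>B. psi p (l p))"
  have "w n - u * exp (\<i> * complex_of_real x)
      = u * (exp (\<i> * complex_of_real s) - exp (\<i> * complex_of_real x))"
    using w_prod_prime_powers[OF B(1,2), of l] B(4) by (simp add: n_def s_def right_diff_distrib)
  then have "norm (w n - u * exp (\<i> * complex_of_real x)) \<le> \<bar>s - x\<bar>"
    using u norm_exp_i_diff_le[of s x] by (auto simp: norm_mult)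
  moreover have "n \<ge> 1" unfolding n_def using B(2)
    by (intro Suc_leI[of 0, simplified One_nat_def[symmetric]] prod_pos) (auto simp: prime_gt_0_nat)
  ultimately show ?thesis using B(3) by (auto simp: s_def)
qed

theorem theorem1:
  shows "{w n | n. n \<ge> 1} \<subseteq> sphere 0 1 \<and> sphere 0 1 \<subseteq> closure {w n | n. n \<ge> 1}"
proof (intro conjI subsetI)
  fix z assume "z \<in> {w n | n. n \<ge> 1}"
  then show "z \<in> sphere 0 1" by (auto simp: norm_w)
next
  fix z :: complex assume "z \<in> sphere 0 1"
  then have z: "norm z = 1" by simp
  (* A point of the lower half circle is the negative of one of the upper half; pi itself is
     excluded as an angle, so -1 is reached as the negative of 1. *)
  have "\<exists>u x. (u = 1 \<or> u = -1) \<and> 0 \<le> x \<and> x < pi \<and> z = u * exp (\<i> * complex_of_real x)"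
  proof -
    have "z \<noteq> 0" using z by auto
    then have polar: "z = exp (\<i> * complex_of_real (Arg z))" using Arg_eq[of z] z by simp
    have bounds: "- pi < Arg z" "Arg z \<le> pi" by (rule mpi_less_Arg, rule Arg_le_pi)
    have shift: "exp (\<i> * complex_of_real (a + pi)) = - exp (\<i> * complex_of_real a)" for a
      by (simp add: distrib_left exp_add)
    consider "Arg z < 0" | "0 \<le> Arg z" "Arg z < pi" | "Arg z = pi" using bounds by linarith
    then show ?thesis
    proof cases
      case 1
      then have "z = - 1 * exp (\<i> * complex_of_real (Arg z + pi))"
        using polar shift[of "Arg z"] by simp
      then show ?thesis using 1 bounds by (intro exI[of _ "-1"] exI[of _ "Arg z + pi"]) auto
    next
      case 2
      then show ?thesis using polar by (intro exI[of _ "1"] exI[of _ "Arg z"]) auto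
    next
      case 3
      then have "z = - 1 * exp (\<i> * complex_of_real 0)" using polar shift[of 0] by simp
      then show ?thesis by (intro exI[of _ "-1"] exI[of _ 0]) auto
    qed
  qed
  then obtain u x where ux: "u = 1 \<or> u = -1" "0 \<le> x" "x < pi"
    "z = u * exp (\<i> * complex_of_real x)" by blast
  show "z \<in> closure {w n | n. n \<ge> 1}"
    unfolding closure_approachable
  proof (intro allI impI)
    fix e :: real assume "e > 0"
    then obtain n where "n \<ge> 1" "norm (w n - z) < e"
      using w_approximates_signed[of x e u] ux by blast
    then show "\<exists>y\<in>{w n | n. n \<ge> 1}. dist y z < e" by (auto simp: dist_norm)
  qed
qed

end
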